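(* Let $N\ge2$, $0<g_1<\cdots<g_N$, $f_{ij}=g_i+g_j$ for $i\ne j$. Let $y\in\mathcal S^\circ=\{y\in(0,1)^N:\sum_iy_i=1\}$ and let $U$ be its moment vector. Multiplication by $Y=\operatorname{diag}(y_1,\dots,y_N)$ is an isomorphism $Y:E_y\to E$, and $$\bigl(B(y)|_E\bigr)^{-1}=-Y\bigl(\mathcal L_y|_{E_y}\bigr)^{-1}Y^{-1}.$$ Consequently, with $\mathfrak S_y:=\mathsf LY:E_y\to\mathbb R^{N-1}$, $$A_N(U)=\mathfrak S_y\bigl(\mathcal L_y|_{E_y}\bigr)^{-1}\mathfrak S_y^{-1}.$$ Hence $$\sigma(A_N(U))=\{\lambda_1^{-1},\dots,\lambda_{N-1}^{-1}\}.$$ If $\mathsf J_U(z):=D_zU(z)$ is the Jacobian of the moment vector as a function of the root coordinates, then $$A_N(U(z))\,\mathsf J_U(z)=\mathsf J_U(z)\operatorname{diag}(\lambda_1^{-1},\dots,\lambda_{N-1}^{-1}).$$ Equivalently, for $p_j(U):=\nabla_Uz_j(U)$, $j=1,\dots,N-1$, $$p_j(U)^{\sf T}A_N(U)=\lambda_j^{-1}p_j(U)^{\sf T}.$$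
   Context: $E=\{v\in\mathbb R^N:\sum_iv_i=0\}$, $E_y=\{u\in\mathbb R^N:\sum_iy_iu_i=0\}$. $B_{ij}(y)=y_if_{ij}$ ($i\ne j$), $B_{ii}(y)=-\sum_{\ell\ne i}f_{i\ell}y_\ell$; $B(y)|_E:E\to E$ is invertible. $(\mathcal L_yu)_i=\sum_{j=1}^N(g_i+g_j)y_j(u_i-u_j)$; it maps $E_y$ into $E_y$. Roots: $z_j=z_j(y)$ is the unique zero of $\zeta\mapsto\sum_iy_i/(g_i-\zeta)$ in $(g_j,g_{j+1})$, $j=1,\dots,N-1$; $y\mapsto z$ is a diffeomorphism of $\mathcal S^\circ$ onto $\prod_j(g_j,g_{j+1})$. $\lambda_j=z_j+\sum_ig_iy_i>0$. Moments: $U_\ell=\sum_ig_i^\ell y_i$, $\ell=1,\dots,N-1$, an affine bijection from the closed simplex onto $\mathcal T=\operatorname{co}\{(g_i,\dots,g_i^{N-1})^{\sf T}\}_{i=1}^N$ with inverse $y(U)$; through these bijections $U$ is viewed as a function of $z$ and $z_j$ as a function of $U$. $\mathsf L:E\to\mathbb R^{N-1}$, $\mathsf Lv=(\sum_ig_i^\ell v_i)_{\ell=1}^{N-1}$, $\mathsf R=\mathsf L^{-1}$, $A_N(U)=-\mathsf L(B(y(U))|_E)^{-1}\mathsf R$. $\sigma(\cdot)$ denotes the spectrum. *)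

theory Defs
  imports "HOL-Analysis.Analysis"
begin

text \<open>
  Coordinates of \<open>\<real>\<^sup>N\<close> and \<open>\<real>\<^sup>N\<^sup>-\<^sup>1\<close> are indexed by finite linearly ordered types \<open>'n\<close> and \<open>'m\<close>
  with \<open>CARD('n) = N\<close> and \<open>CARD('m) = N - 1\<close>. \<open>pos\<close> is the increasing bijection of such a type
  onto \<open>{1..CARD('a)}\<close> and \<open>idx\<close> is its inverse; they serve to express index arithmetic such as
  \<open>g\<^sub>j\<^sub>+\<^sub>1\<close> and powers such as \<open>g\<^sub>i\<^sup>\<ell>\<close>.
\<close>

definition pos :: "'a::{finite,linorder} \<Rightarrow> nat" where
  "pos i = card {..i}"

definition idx :: "nat \<Rightarrow> 'a::{finite,linorder}" where
  "idx k = (THE i. pos i = k)"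

definition E :: "(real^'n) set" where
  "E = {v. (\<Sum>i\<in>UNIV. v$i) = 0}"

definition Ey :: "real^'n \<Rightarrow> (real^'n) set" where
  "Ey y = {u. (\<Sum>i\<in>UNIV. y$i * u$i) = 0}"

definition open_simplex :: "(real^'n) set" where
  "open_simplex = {y. (\<forall>i. 0 < y$i \<and> y$i < 1) \<and> (\<Sum>i\<in>UNIV. y$i) = 1}"

definition closed_simplex :: "(real^'n) set" where
  "closed_simplex = {y. (\<forall>i. 0 \<le> y$i) \<and> (\<Sum>i\<in>UNIV. y$i) = 1}"

definition diag :: "real^'k \<Rightarrow> real^'k^'k" where
  "diag d = (\<chi> i j. if i = j then d$i else 0)"

definition Bmat :: "('n \<Rightarrow> 'n \<Rightarrow> real) \<Rightarrow> real^'n \<Rightarrow> real^'n^'n" where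
  "Bmat f y = (\<chi> i j. if i = j then - (\<Sum>l\<in>UNIV - {i}. f i l * y$l) else y$i * f i j)"

definition Lop :: "real^'n \<Rightarrow> real^'n \<Rightarrow> real^'n \<Rightarrow> real^'n" where
  "Lop g y u = (\<chi> i. \<Sum>j\<in>UNIV. (g$i + g$j) * y$j * (u$i - u$j))"

text \<open>The vector of roots; \<open>g $ idx (pos j)\<close> and \<open>g $ idx (pos j + 1)\<close> are \<open>g\<^sub>j\<close> and \<open>g\<^sub>j\<^sub>+\<^sub>1\<close>.\<close>

definition roots ::
  "real^'n::{finite,linorder} \<Rightarrow> real^'n::{finite,linorder} \<Rightarrow> real^'m::{finite,linorder}" where
  "roots g y = (\<chi> j. THE \<zeta>. g $ idx (pos j) < \<zeta> \<and> \<zeta> < g $ idx (pos j + 1)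
                         \<and> (\<Sum>i\<in>UNIV. y$i / (g$i - \<zeta>)) = 0)"

definition lam ::
  "real^'n::{finite,linorder} \<Rightarrow> real^'n::{finite,linorder} \<Rightarrow> 'm::{finite,linorder} \<Rightarrow> real" where
  "lam g y j = roots g y $ j + (\<Sum>i\<in>UNIV. g$i * y$i)"

text \<open>
  One formula for both moment maps: restricted to the closed simplex this is \<open>y \<mapsto> U\<close>,
  restricted to \<open>E\<close> it is the map \<open>v \<mapsto> (\<Sum>\<^sub>i g\<^sub>i\<^sup>\<ell> v\<^sub>i)\<^sub>\<ell>\<close> whose inverse is \<open>R\<close>.
\<close>

definition moments ::
  "real^'n \<Rightarrow> real^'n \<Rightarrow> real^'m::{finite,linorder}" where
  "moments g v = (\<chi> l. \<Sum>i\<in>UNIV. g$i ^ pos l * v$i)"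

definition y_of_U :: "real^'n \<Rightarrow> real^'m::{finite,linorder} \<Rightarrow> real^'n" where
  "y_of_U g = inv_into closed_simplex (moments g)"

definition U_of_z ::
  "real^'n::{finite,linorder} \<Rightarrow> real^'m::{finite,linorder} \<Rightarrow> real^'m::{finite,linorder}" where
  "U_of_z g z = moments g (inv_into open_simplex (roots g) z)"

definition z_of_U ::
  "real^'n::{finite,linorder} \<Rightarrow> real^'m::{finite,linorder} \<Rightarrow> real^'m::{finite,linorder}" where
  "z_of_U g U = roots g (y_of_U g U)"

text \<open>The linear operator \<open>A\<^sub>N(U)\<close> on \<open>\<real>\<^sup>N\<^sup>-\<^sup>1\<close>, and its matrix in the standard basis.\<close>

definition A_op ::
  "real^'n \<Rightarrow> ('n \<Rightarrow> 'n \<Rightarrow> real) \<Rightarrow> real^'m::{finite,linorder}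
    \<Rightarrow> real^'m::{finite,linorder} \<Rightarrow> real^'m::{finite,linorder}" where
  "A_op g f U w =
     - moments g (inv_into E ((*v) (Bmat f (y_of_U g U))) (inv_into E (moments g) w))"

definition A_mat ::
  "real^'n \<Rightarrow> ('n \<Rightarrow> 'n \<Rightarrow> real) \<Rightarrow> real^'m::{finite,linorder}
    \<Rightarrow> real^'m::{finite,linorder}^'m::{finite,linorder}" where
  "A_mat g f U = matrix (A_op g f U)"

definition S_op :: "real^'n \<Rightarrow> real^'n \<Rightarrow> real^'n \<Rightarrow> real^'m::{finite,linorder}" where
  "S_op g y u = moments g (diag y *v u)"

text \<open>The full (complex) spectrum of a real matrix.\<close>

definition spectrum :: "real^'k^'k \<Rightarrow> complex set" where
  "spectrum A = {c. \<not> invertible (mat c - map_matrix complex_of_real A)}"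

definition gradient :: "('a::real_inner \<Rightarrow> real) \<Rightarrow> 'a \<Rightarrow> 'a" where
  "gradient h x = (THE D. GDERIV h x :> D)"

end

theory Submission
  imports Defs
begin

text \<open>
  The vectors \<open>u\<^sup>k = (1 / (g\<^sub>i - z\<^sub>k))\<^sub>i\<close> satisfy \<open>L\<^sub>y u\<^sup>k = \<lambda>\<^sub>k u\<^sup>k\<close>, because \<open>g\<^sub>i u\<^sup>k\<^sub>i = 1 + z\<^sub>k u\<^sup>k\<^sub>i\<close>.
  By partial fractions they are orthogonal for the \<open>y\<close>-weighted inner product, so they form a basis
  of \<open>E\<^sub>y\<close>. Since \<open>B(y) Y = - Y L\<^sub>y\<close>, the operator \<open>A\<^sub>N(U)\<close> is diagonal in the basis of the columns
  \<open>L Y u\<^sup>k\<close> of a matrix \<open>P\<close>, with eigenvalues \<open>1 / \<lambda>\<^sub>k\<close>. Differentiating \<open>\<Sum>\<^sub>i y\<^sub>i / (g\<^sub>i - z\<^sub>j) = 0\<close>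
  in the direction \<open>Y u\<^sup>k\<close> and using orthogonality once more shows that \<open>z\<^sub>j\<close> has derivative
  \<open>- 1\<close> if \<open>j = k\<close> and \<open>0\<close> otherwise; hence \<open>D\<^sub>U z = - P\<^sup>-\<^sup>1\<close> and, by the inverse function theorem,
  \<open>D\<^sub>z U = - P\<close>.
\<close>

subsection \<open>Positions and gaps\<close>

lemma pos_strict_mono: "strict_mono (pos :: 'a::{finite,linorder} \<Rightarrow> nat)"
  by (auto intro!: strict_monoI psubset_card_mono simp: pos_def)

lemma bij_betw_pos: "bij_betw pos (UNIV :: 'a::{finite,linorder} set) {1..CARD('a)}"
proof -
  have inj: "inj (pos :: 'a \<Rightarrow> nat)"
    using pos_strict_mono by (rule strict_mono_imp_inj_on)
  have sub: "range (pos :: 'a \<Rightarrow> nat) \<subseteq> {1..CARD('a)}"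
    by (auto simp: pos_def Suc_le_eq card_gt_0_iff intro!: card_mono)
  have "range (pos :: 'a \<Rightarrow> nat) = {1..CARD('a)}"
    using inj sub by (intro card_subset_eq) (auto simp: card_image)
  with inj show ?thesis by (simp add: bij_betw_def)
qed

lemma pos_idx:
  assumes "1 \<le> k" "k \<le> CARD('a::{finite,linorder})"
  shows "pos (idx k :: 'a) = k"
proof -
  have "k \<in> range (pos :: 'a \<Rightarrow> nat)"
    using assms bij_betw_imp_surj_on[OF bij_betw_pos[where 'a='a]] by auto
  then obtain i :: 'a where i: "pos i = k" by auto
  then have "idx k = i"
    unfolding idx_def using strict_mono_imp_inj_on[OF pos_strict_mono[where 'a='a]]
    by (intro the_equality) (auto dest: injD)
  with i show ?thesis by simp
qed

lemma pos_range: "1 \<le> pos (j :: 'a::{finite,linorder})" "pos j \<le> CARD('a)"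
  using bij_betwE[OF bij_betw_pos[where 'a='a]] by auto

text \<open>The index \<open>pos j\<close> is at most \<open>CARD('m)\<close>, so both
  \<open>pos j\<close> and \<open>pos j + 1\<close> are genuine positions in \<open>'n\<close>.
  Being consecutive, they leave no node strictly between the two they name.\<close>

lemma root_interval:
  fixes g :: "real^'n::{finite,linorder}" and j :: "'m::{finite,linorder}"
  assumes card: "CARD('n) = Suc CARD('m)" and mono: "\<And>i k. i < k \<Longrightarrow> g$i < g$k"
  shows "g $ idx (pos j) < g $ idx (pos j + 1)"
    and "g $ i \<le> g $ idx (pos j) \<or> g $ idx (pos j + 1) \<le> g $ i"
proof -
  have p: "pos (idx (pos j) :: 'n) = pos j" "pos (idx (pos j + 1) :: 'n) = pos j + 1"
    using pos_range[of j] card by (auto intro!: pos_idx)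
  have lt: "a < b \<longleftrightarrow> pos a < pos b" for a b :: 'n
    using strict_mono_less[OF pos_strict_mono] by blast
  show "g $ idx (pos j) < g $ idx (pos j + 1)"
    by (rule mono) (simp add: lt p[simplified])
  have "i \<le> idx (pos j) \<or> idx (pos j + 1) \<le> i"
    using p by (simp add: lt flip: not_less)
  then show "g $ i \<le> g $ idx (pos j) \<or> g $ idx (pos j + 1) \<le> g $ i"
    using mono by (metis less_eq_real_def order_le_less)
qed

lemma root_intervals_disjoint:
  fixes g :: "real^'n::{finite,linorder}" and j k :: "'m::{finite,linorder}"
  assumes card: "CARD('n) = Suc CARD('m)" and mono: "\<And>i k. i < k \<Longrightarrow> g$i < g$k" and "j < k"
  shows "g $ idx (pos j + 1) \<le> g $ idx (pos k)"
proof -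
  have p: "pos (idx (pos k) :: 'n) = pos k" "pos (idx (pos j + 1) :: 'n) = pos j + 1"
    using pos_range[of j] pos_range[of k] card by (auto intro!: pos_idx)
  have "pos j < pos k" using \<open>j < k\<close> strict_monoD[OF pos_strict_mono] by blast
  then have "\<not> idx (pos k) < (idx (pos j + 1) :: 'n)"
    using p strict_monoD[OF pos_strict_mono, of "idx (pos k) :: 'n" "idx (pos j + 1)"] by auto
  then show ?thesis using mono by (metis less_eq_real_def not_less_iff_gr_or_eq)
qed

subsection \<open>Roots of the secular function\<close>

definition secular :: "real^'n \<Rightarrow> real^'n \<Rightarrow> real \<Rightarrow> real" where
  "secular g y \<zeta> = (\<Sum>i\<in>UNIV. y$i / (g$i - \<zeta>))"

text \<open>Termwise divided difference in the spectral variable. It serves three times: for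
  monotonicity between poles, for orthogonality of the eigenvectors, and for the derivative of the
  roots.\<close>

lemma secular_diff:
  assumes "\<And>i. g$i \<noteq> s" "\<And>i. g$i \<noteq> t"
  shows "secular g y t - secular g y s = (t - s) * (\<Sum>i\<in>UNIV. y$i / ((g$i - s) * (g$i - t)))"
  unfolding secular_def sum_subtractf[symmetric] sum_distrib_left
proof (rule sum.cong[OF refl])
  fix i
  show "y$i / (g$i - t) - y$i / (g$i - s) = (t - s) * (y$i / ((g$i - s) * (g$i - t)))"
    using assms[of i] by (simp add: divide_simps) (simp add: algebra_simps)
qed

text \<open>Each node lies on the same side of \<open>s\<close> and of \<open>t\<close>, so the two
  factors share a sign. The case \<open>s = t\<close> is allowed and later yields the limiting
  denominator.\<close>

lemma gap_weight_pos:
  fixes g y :: "real^'n"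
  assumes gap: "\<And>i. g$i \<le> a \<or> b \<le> g$i" and pos: "\<And>i. 0 < y$i"
    and s: "a < s" "s < b" and t: "a < t" "t < b"
  shows "0 < (\<Sum>i\<in>UNIV. y$i / ((g$i - s) * (g$i - t)))"
proof (rule sum_pos)
  fix i
  have "0 < (g$i - s) * (g$i - t)"
    using gap[of i] s t by (auto intro: mult_neg_neg mult_pos_pos)
  then show "0 < y$i / ((g$i - s) * (g$i - t))" using pos[of i] by simp
qed auto

lemma secular_strict_mono:
  fixes g y :: "real^'n"
  assumes gap: "\<And>i. g$i \<le> a \<or> b \<le> g$i" and pos: "\<And>i. 0 < y$i"
    and st: "a < s" "s < t" "t < b"
  shows "secular g y s < secular g y t"
proof -
  have ne: "g$i \<noteq> s" "g$i \<noteq> t" for i using gap[of i] st by auto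
  have "0 < (t - s) * (\<Sum>i\<in>UNIV. y$i / ((g$i - s) * (g$i - t)))"
    using gap_weight_pos[OF gap pos, of s t] st by simp
  then show ?thesis using secular_diff[of g s t y, OF ne] by simp
qed

text \<open>Existence is the intermediate value theorem after clearing the poles at both ends;
  uniqueness is strict monotonicity inside the gap.\<close>

lemma secular_root_ex1:
  fixes g y :: "real^'n"
  assumes gap: "\<And>i. g$i \<le> g$p \<or> g$q \<le> g$i" and pq: "g$p < g$q" and pos: "\<And>i. 0 < y$i"
    and inj: "inj (($) g)"
  shows "\<exists>!\<zeta>. g$p < \<zeta> \<and> \<zeta> < g$q \<and> secular g y \<zeta> = 0"
proof -
  define a b where "a = g$p" and "b = g$q"
  have ab: "a < b" using pq by (simp add: a_def b_def)
  have "p \<noteq> q" using pq by auto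
  define R where "R \<zeta> = (\<Sum>i\<in>UNIV - {p,q}. y$i / (g$i - \<zeta>))" for \<zeta>
  \<comment> \<open>the secular function with its two poles at the endpoints cleared\<close>
  define h where "h \<zeta> = - y$p * (b - \<zeta>) + y$q * (\<zeta> - a) + (\<zeta> - a) * (b - \<zeta>) * R \<zeta>" for \<zeta>
  \<comment> \<open>The gap hypothesis keeps the other nodes out of the interior, injectivity keeps
    them off the endpoints; hence \<open>R\<close> is continuous on the closed interval.\<close>
  have ne: "g$i \<noteq> \<zeta>" if "i \<notin> {p,q}" "a \<le> \<zeta>" "\<zeta> \<le> b" for i \<zeta>
  proof -
    have "g$i \<noteq> a" "g$i \<noteq> b" using that(1) inj by (auto simp: a_def b_def dest: injD)
    then show ?thesis using gap[of i] that by (auto simp: a_def b_def)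
  qed
  have "continuous_on {a..b} h"
    unfolding h_def R_def by (intro continuous_intros) (use ne in auto)
  moreover have "h a \<le> 0" "0 \<le> h b"
    using pos[of p] pos[of q] ab by (auto simp: h_def)
  ultimately obtain \<zeta> where \<zeta>: "a \<le> \<zeta>" "\<zeta> \<le> b" "h \<zeta> = 0"
    using IVT'[of h a 0 b] ab by auto
  \<comment> \<open>The endpoint values are \<open>- y$p * (b - a)\<close> and
    \<open>y$q * (b - a)\<close>, both nonzero.\<close>
  have "\<zeta> \<noteq> a" "\<zeta> \<noteq> b"
    using \<zeta>(3) pos[of p] pos[of q] ab by (auto simp: h_def)
  with \<zeta> have in_ab: "a < \<zeta>" "\<zeta> < b" by auto
  have "secular g y \<zeta> = y$p / (a - \<zeta>) + (y$q / (b - \<zeta>) + R \<zeta>)"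
  proof -
    have "UNIV = insert p (insert q (UNIV - {p,q}))" by auto
    then have "secular g y \<zeta> = (\<Sum>i\<in>insert p (insert q (UNIV - {p,q})). y$i / (g$i - \<zeta>))"
      unfolding secular_def by metis
    then show ?thesis using \<open>p \<noteq> q\<close> by (simp add: R_def a_def b_def)
  qed
  also have "\<dots> = h \<zeta> / ((\<zeta> - a) * (b - \<zeta>))"
    using in_ab unfolding h_def by (simp add: divide_simps) (simp add: algebra_simps)
  finally have root: "secular g y \<zeta> = 0" using \<zeta> by simp
  show ?thesis
  proof (rule ex1I[of _ \<zeta>])
    show "g$p < \<zeta> \<and> \<zeta> < g$q \<and> secular g y \<zeta> = 0"
      using in_ab root by (simp add: a_def b_def)
    fix t assume t: "g$p < t \<and> t < g$q \<and> secular g y t = 0"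
    show "t = \<zeta>"
      using secular_strict_mono[OF gap pos, of t \<zeta>] secular_strict_mono[OF gap pos, of \<zeta> t]
        t in_ab root by (auto simp: a_def b_def dest: linorder_neqE_linordered_idom)
  qed
qed

text \<open>Caratheodory's form of differentiability, which takes the place of the implicit function
  theorem: the remainder is \<open>(\<Phi> x - \<Phi> y) \<bullet> (x - y)\<close>, controlled by
  Cauchy-Schwarz.\<close>

lemma has_derivative_caratheodory:
  fixes r :: "'a::real_inner \<Rightarrow> real"
  assumes eq: "eventually (\<lambda>x. r x - r y = \<Phi> x \<bullet> (x - y)) (at y)" and cont: "isCont \<Phi> y"
  shows "(r has_derivative (\<lambda>h. \<Phi> y \<bullet> h)) (at y)"
  unfolding has_derivative_iff_norm
proof
  show "bounded_linear ((\<bullet>) (\<Phi> y))" by (rule bounded_linear_inner_right)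
  have "((\<lambda>x. norm (\<Phi> x - \<Phi> y)) \<longlongrightarrow> 0) (at y)"
    using cont by (simp add: isCont_def LIM_zero tendsto_norm_zero)
  then show "((\<lambda>x. norm (r x - r y - \<Phi> y \<bullet> (x - y)) / norm (x - y)) \<longlongrightarrow> 0) (at y)"
  proof (rule Lim_null_comparison[rotated])
    show "\<forall>\<^sub>F x in at y. norm (norm (r x - r y - \<Phi> y \<bullet> (x - y)) / norm (x - y)) \<le> norm (\<Phi> x - \<Phi> y)"
      using eq
    proof eventually_elim
      case (elim x)
      have "\<bar>(\<Phi> x - \<Phi> y) \<bullet> (x - y)\<bar> \<le> norm (\<Phi> x - \<Phi> y) * norm (x - y)"
        by (rule Cauchy_Schwarz_ineq2)
      then show ?case using elim
        by (cases "x = y") (auto simp: inner_diff_left divide_simps)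
    qed
  qed
qed

lemma open_positive: "open {x :: real^'n. \<forall>i. 0 < x$i}"
proof -
  have "open (\<Inter>i\<in>UNIV. {x :: real^'n. 0 < x$i})"
    by (intro open_INT ballI open_Collect_less continuous_intros) auto
  then show ?thesis by (simp add: Collect_all_eq)
qed

lemma eventually_positive:
  fixes y :: "real^'n"
  assumes "\<And>i. 0 < y$i"
  shows "eventually (\<lambda>x. \<forall>i. 0 < x$i) (at y)"
  using eventually_at_in_open'[OF open_positive, of y] assms by simp

section \<open>Roots as functions of the weights: location, continuity, derivative; injectivity of
  the moments\<close>

context
  fixes g :: "real^'n::{finite,linorder}"
  assumes card: "CARD('n) = Suc CARD('m::{finite,linorder})" and mono: "\<And>i j. i < j \<Longrightarrow> g$i < g$j"
begin

lemma inj_nodes: "inj (($) g)"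
proof (rule injI)
  show "i = j" if "g$i = g$j" for i j
    using that mono[of i j] mono[of j i] by (cases i j rule: linorder_cases) auto
qed

text \<open>Stated on the whole positive orthant, an open set, so that the roots can be
  differentiated in every ambient direction.\<close>

lemma roots_props:
  fixes j :: "'m::{finite,linorder}"
  assumes "\<And>i. 0 < y$i"
  shows "g $ idx (pos j) < roots g y $ j" "roots g y $ j < g $ idx (pos j + 1)" "secular g y (roots g y $ j) = 0"
proof -
  have "\<exists>!\<zeta>. g $ idx (pos j) < \<zeta> \<and> \<zeta> < g $ idx (pos j + 1) \<and> secular g y \<zeta> = 0"
    using root_interval[OF card mono] assms inj_nodes by (intro secular_root_ex1) auto
  from theI'[OF this] show "g $ idx (pos j) < roots g y $ j" "roots g y $ j < g $ idx (pos j + 1)"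
     "secular g y (roots g y $ j) = 0"
    by (auto simp: roots_def secular_def)
qed

lemma roots_neq:
  fixes j :: "'m::{finite,linorder}"
  assumes "\<And>i. 0 < y$i"
  shows "g$i \<noteq> roots g y $ j" 
  using roots_props[OF assms, of j] root_interval(2)[OF card mono, of i j] by auto

lemma roots_distinct:
  fixes j :: "'m::{finite,linorder}"
  assumes "\<And>i. 0 < y$i" "j \<noteq> k"
  shows "roots g y $ j \<noteq> roots g y $ k" 
  using roots_props[OF assms(1), of j] roots_props[OF assms(1), of k] \<open>j \<noteq> k\<close>
    root_intervals_disjoint[OF card mono, of j k] root_intervals_disjoint[OF card mono, of k j]
  by (cases j k rule: linorder_cases) auto

lemma isCont_secular: "isCont (\<lambda>x. secular g x c) y"
  unfolding secular_def divide_inverse by (intro continuous_intros)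

text \<open>At a fixed test point \<open>d\<close> beside the root, the sign of the secular function
  persists for weights near \<open>y\<close>; monotonicity then keeps the perturbed root on the same
  side of \<open>d\<close>.\<close>

lemma isCont_roots:
  fixes j :: "'m::{finite,linorder}"
  assumes pos: "\<And>i. 0 < y$i"
  shows "isCont (\<lambda>x. roots g x $ j) y"
  unfolding isCont_def
proof (rule order_tendstoI)
  let ?a = "g $ idx (pos j)" and ?b = "g $ idx (pos j + 1)" and ?z = "roots g y $ j"
  note gap = root_interval(2)[OF card mono, of _ j]
  note z = roots_props[OF pos, of j]
  have ev: "eventually (\<lambda>x. \<forall>i. 0 < x$i) (at y)"
    using pos by (rule eventually_positive)
  have sec: "((\<lambda>x. secular g x c) \<longlongrightarrow> secular g y c) (at y)" for c
    using isCont_secular by (simp add: isCont_def)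
  fix c
  {
    assume "c < ?z"
    \<comment> \<open>The midpoint pulls the test point into the gap when \<open>c\<close> lies to
      its left.\<close>
    define d where "d = max c ((?a + ?z) / 2)"
    have d: "?a < d" "d < ?z" "c \<le> d" using \<open>c < ?z\<close> z by (auto simp: d_def less_max_iff_disj)
    have "secular g y d < 0"
      using secular_strict_mono[OF gap pos d(1,2)] z by auto
    with sec have "eventually (\<lambda>x. secular g x d < 0) (at y)" by (rule order_tendstoD(2))
    with ev show "eventually (\<lambda>x. c < roots g x $ j) (at y)"
    proof eventually_elim
      case (elim x)
      then have px: "\<And>i. 0 < x$i" by blast
      note zx = roots_props[OF px, of j]
      have "\<not> roots g x $ j \<le> d"
        using secular_strict_mono[OF gap px zx(1), of d] d z zx elim by fastforce
      then show ?case using d by simp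
    qed
  next
    assume "?z < c"
    define d where "d = min c ((?b + ?z) / 2)"
    have d: "d < ?b" "?z < d" "d \<le> c" using \<open>?z < c\<close> z by (auto simp: d_def min_less_iff_disj)
    have "0 < secular g y d"
      using secular_strict_mono[OF gap pos z(1) d(2,1)] z by auto
    with sec have "eventually (\<lambda>x. 0 < secular g x d) (at y)" by (rule order_tendstoD(1))
    with ev show "eventually (\<lambda>x. roots g x $ j < c) (at y)"
    proof eventually_elim
      case (elim x)
      then have px: "\<And>i. 0 < x$i" by blast
      note zx = roots_props[OF px, of j]
      have "\<not> d \<le> roots g x $ j"
        using secular_strict_mono[OF gap px _ _ zx(2), of d] d z zx elim by fastforce
      then show ?case using d by simp
    qed
  }
qed

text \<open>An exact difference identity with a denominator \<open>D x\<close> that depends on the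
  moved root; continuity of the roots makes \<open>\<Phi>\<close> continuous, and Caratheodory's
  criterion applies.\<close>

lemma roots_has_derivative:
  fixes j :: "'m::{finite,linorder}"
  assumes pos: "\<And>i. 0 < y$i"
  shows "((\<lambda>x. roots g x $ j) has_derivative
          (\<lambda>h. - (\<Sum>i\<in>UNIV. h$i / (g$i - roots g y $ j)) / (\<Sum>i\<in>UNIV. y$i / (g$i - roots g y $ j)\<^sup>2))) (at y)"
proof -
  define D where "D x = (\<Sum>i\<in>UNIV. y$i / ((g$i - roots g y $ j) * (g$i - roots g x $ j)))" for x
  define \<Phi> where "\<Phi> x = - ((\<chi> i. 1 / (g$i - roots g x $ j)) /\<^sub>R D x)" for x
  note gap = root_interval(2)[OF card mono, of _ j]
  have ev: "eventually (\<lambda>x. \<forall>i. 0 < x$i) (at y)"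
    using pos by (rule eventually_positive)
  have \<Phi>_inner: "\<Phi> x \<bullet> h = - (\<Sum>i\<in>UNIV. h$i / (g$i - roots g x $ j)) / D x" for x h
  proof -
    have "(\<chi> i. 1 / (g$i - roots g x $ j)) \<bullet> h = (\<Sum>i\<in>UNIV. h$i / (g$i - roots g x $ j))"
      by (simp add: inner_vec_def)
    then show ?thesis by (simp add: \<Phi>_def divide_inverse_commute[of _ "D x"])
  qed
  have Dpos: "0 < D x" if "\<And>i. 0 < x$i" for x
    using gap_weight_pos[OF gap pos] roots_props[OF pos, of j] roots_props[OF that, of j]
    unfolding D_def by blast
  have "eventually (\<lambda>x. roots g x $ j - roots g y $ j = \<Phi> x \<bullet> (x - y)) (at y)"
    using ev
  proof eventually_elim
    case (elim x)
    then have px: "\<And>i. 0 < x$i" by blast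
    \<comment> \<open>The secular function of \<open>y\<close> is evaluated at the root of
      \<open>x\<close> in two ways: as a divided difference from the root of \<open>y\<close>, and
      by linearity in the weights, since that of \<open>x\<close> vanishes there.\<close>
    have "(roots g x $ j - roots g y $ j) * D x = secular g y (roots g x $ j)"
      using secular_diff[of g "roots g y $ j" "roots g x $ j" y] roots_neq[OF pos] roots_neq[OF px]
        roots_props[OF pos] by (simp add: D_def)
    also have "\<dots> = - (\<Sum>i\<in>UNIV. (x - y)$i / (g$i - roots g x $ j))"
      using roots_props(3)[OF px, of j]
      by (simp add: secular_def diff_divide_distrib sum_subtractf)
    finally show ?case using Dpos[OF px] by (simp add: \<Phi>_inner field_simps)
  qed
  moreover have "isCont \<Phi> y"
  proof -
    have "isCont D y"
      unfolding D_def by (intro continuous_intros isCont_roots pos) (use roots_neq[OF pos] in auto)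
    moreover have "isCont (\<lambda>x. \<chi> i. 1 / (g$i - roots g x $ j)) y"
      unfolding isCont_def
      by (intro tendsto_vec_lambda tendsto_intros isCont_roots[OF pos, unfolded isCont_def])
        (use roots_neq[OF pos] in auto)
    ultimately show ?thesis
      unfolding \<Phi>_def using Dpos[OF pos] by (intro continuous_intros) auto
  qed
  ultimately have "((\<lambda>x. roots g x $ j) has_derivative (\<lambda>h. \<Phi> y \<bullet> h)) (at y)"
    by (rule has_derivative_caratheodory)
  then show ?thesis by (simp add: \<Phi>_inner D_def power2_eq_square)
qed

text \<open>Vandermonde: test \<open>v\<close> against the polynomial vanishing at all nodes but one.\<close>

lemma moments_inj:
  fixes v :: "real^'n::{finite,linorder}"
  assumes sum0: "(\<Sum>i\<in>UNIV. v$i) = 0" and m0: "moments g v = (0 :: real^'m::{finite,linorder})"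
  shows "v = 0"
proof -
  \<comment> \<open>The moments begin with the first power because \<open>pos\<close> starts at 1;
    the zeroth power is supplied by \<open>sum0\<close>.\<close>
  have pw: "(\<Sum>i\<in>UNIV. g$i ^ l * v$i) = 0" if "l \<le> CARD('m)" for l
  proof (cases "l = 0")
    case False
    then have "pos (idx l :: 'm) = l" using that by (intro pos_idx) auto
    then show ?thesis using arg_cong[OF m0, of "\<lambda>w. w $ idx l"] by (simp add: moments_def)
  qed (use sum0 in simp)
  have "v$k = 0" for k
  proof -
    define p where "p = (\<Prod>i\<in>UNIV - {k}. [:- g$i, 1:])"
    have deg: "degree p \<le> CARD('m)"
      unfolding p_def by (subst degree_prod_sum_eq) (auto simp: card)
    have "(\<Sum>i\<in>UNIV. poly p (g$i) * v$i)
        = (\<Sum>i\<in>UNIV. \<Sum>l\<le>degree p. coeff p l * (g$i ^ l * v$i))"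
      by (simp add: poly_altdef sum_distrib_right mult.assoc)
    also have "\<dots> = (\<Sum>l\<le>degree p. coeff p l * (\<Sum>i\<in>UNIV. g$i ^ l * v$i))"
      by (subst sum.swap) (simp add: sum_distrib_left)
    also have "\<dots> = 0" using pw deg by (intro sum.neutral) auto
    finally have "(\<Sum>i\<in>UNIV. poly p (g$i) * v$i) = 0" .
    moreover have "poly p (g$i) = 0" if "i \<noteq> k" for i
      using that by (auto simp: p_def poly_prod)
    then have "(\<Sum>i\<in>UNIV. poly p (g$i) * v$i) = poly p (g$k) * v$k"
      by (subst sum.remove[of _ k]) (auto intro!: sum.neutral)
    moreover have "poly p (g$k) \<noteq> 0"
      using inj_nodes by (auto simp: p_def poly_prod dest: injD)
    ultimately show ?thesis by simp
  qed
  then show ?thesis by (simp add: vec_eq_iff)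
qed

end

subsection \<open>Matrices, spectra and gradients\<close>

lemma diag_mult_vec: "(diag d *v v) $ i = d$i * v$i"
proof -
  have "(\<Sum>j\<in>UNIV. (if i = j then d$i else 0) * v$j) = (\<Sum>j\<in>UNIV. if i = j then d$i * v$j else 0)"
    by (intro sum.cong) auto
  then show ?thesis by (simp add: diag_def matrix_vector_mult_def)
qed

text \<open>In row \<open>i\<close> the diagonal sum pairs term by term with the off-diagonal
  entries, which produces the differences \<open>u$i - u$j\<close>.\<close>

lemma Bmat_diag:
  fixes y u :: "real^'n"
  assumes "\<And>i j. i \<noteq> j \<Longrightarrow> f i j = g$i + g$j"
  shows "Bmat f y *v (diag y *v u) = - (diag y *v Lop g y u)"
proof (rule vec_eq_iff[THEN iffD2, rule_format])
  fix i
  have off: "(\<Sum>j\<in>UNIV - {i}. Bmat f y $ i $ j * (y$j * u$j))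
      = (\<Sum>j\<in>UNIV - {i}. y$i * ((g$i + g$j) * y$j * u$j))"
    by (intro sum.cong) (use assms in \<open>auto simp: Bmat_def\<close>)
  have diag: "Bmat f y $ i $ i = - (\<Sum>j\<in>UNIV - {i}. (g$i + g$j) * y$j)"
    unfolding Bmat_def by (auto intro!: sum.cong simp: assms)
  have "(Bmat f y *v (diag y *v u)) $ i = (\<Sum>j\<in>UNIV. Bmat f y $ i $ j * (y$j * u$j))"
    by (subst matrix_vector_mult_def) (simp add: diag_mult_vec)
  also have "\<dots> = Bmat f y $ i $ i * (y$i * u$i)
      + (\<Sum>j\<in>UNIV - {i}. Bmat f y $ i $ j * (y$j * u$j))"
    by (rule sum.remove) auto
  also have "\<dots> = - (y$i * (\<Sum>j\<in>UNIV - {i}. (g$i + g$j) * y$j * (u$i - u$j)))"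
    unfolding off diag
    by (simp add: sum_distrib_left sum_distrib_right algebra_simps flip: sum.distrib sum_subtractf sum_negf)
  also have "(\<Sum>j\<in>UNIV - {i}. (g$i + g$j) * y$j * (u$i - u$j)) = Lop g y u $ i"
    unfolding Lop_def by (subst sum.remove[of UNIV i]) auto
  finally show "(Bmat f y *v (diag y *v u)) $ i = (- (diag y *v Lop g y u)) $ i"
    by (simp add: diag_mult_vec)
qed

lemma moments_eq_matrix: "moments g v = (\<chi> l i. g$i ^ pos l) *v v"
  by (simp add: moments_def matrix_vector_mult_def)

lemma moments_linear: "linear (moments g)"
  unfolding moments_eq_matrix by (rule matrix_vector_mul_linear)

text \<open>Of the four sums obtained by expanding, one collapses by normalisation and one by
  \<open>u \<in> Ey y\<close>. What remains is a multiplication operator minus a constant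
  vector.\<close>

lemma Lop_on_Ey:
  assumes "u \<in> Ey y" "(\<Sum>i\<in>UNIV. y$i) = 1"
  shows "Lop g y u $ i = (g$i + (\<Sum>j\<in>UNIV. g$j * y$j)) * u$i - (\<Sum>j\<in>UNIV. g$j * y$j * u$j)"
proof -
  have "Lop g y u $ i = (\<Sum>j\<in>UNIV. g$i * u$i * y$j + u$i * (g$j * y$j) - g$i * (y$j * u$j) - g$j * y$j * u$j)"
    by (simp add: Lop_def algebra_simps)
  also have "\<dots> = g$i * u$i * (\<Sum>j\<in>UNIV. y$j) + u$i * (\<Sum>j\<in>UNIV. g$j * y$j)
      - g$i * (\<Sum>j\<in>UNIV. y$j * u$j) - (\<Sum>j\<in>UNIV. g$j * y$j * u$j)"
    by (simp add: sum_distrib_left sum.distrib sum_subtractf)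
  finally show ?thesis using assms by (simp add: Ey_def algebra_simps)
qed

lemma diag_matrix_mult:
  fixes A :: "real^'k^'n"
  shows "(diag d ** A) $ i $ j = d$i * A$i$j"
proof -
  have "(\<Sum>l\<in>UNIV. (if i = l then d$i else 0) * A$l$j) = (\<Sum>l\<in>UNIV. if i = l then d$i * A$l$j else 0)"
    by (intro sum.cong) auto
  then show ?thesis by (simp add: diag_def matrix_matrix_mult_def)
qed

lemma matrix_diff_ldistrib: "A ** (B - C) = A ** B - A ** (C :: 'a::ring_1^'l^'k)"
  by (simp add: vec_eq_iff matrix_matrix_mult_def right_diff_distrib sum_subtractf)

lemma matrix_diff_rdistrib: "(A - B) ** C = A ** C - B ** (C :: 'a::ring_1^'l^'k)"
  by (simp add: vec_eq_iff matrix_matrix_mult_def left_diff_distrib sum_subtractf)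

lemma matrix_mult_map_of_real:
  fixes A :: "real^'k^'n" and B :: "real^'l^'k"
  shows "map_matrix complex_of_real A ** map_matrix complex_of_real B = map_matrix complex_of_real (A ** B)"
  by (simp add: vec_eq_iff matrix_matrix_mult_def)

text \<open>The determinant of \<open>c\<close> minus the matrix is unchanged by conjugation, and
  for a diagonal matrix it is the product of the \<open>c - d$k\<close>.\<close>

lemma spectrum_similar_diag:
  fixes P Q :: "real^'k^'k"
  assumes PQ: "P ** Q = mat 1" and QP: "Q ** P = mat 1"
  shows "spectrum (P ** diag d ** Q) = range (\<lambda>k. complex_of_real (d$k))"
proof -
  let ?C = "map_matrix complex_of_real"
  have one: "?C (mat 1 :: real^'k^'k) = mat 1"
    by (simp add: vec_eq_iff mat_def)
  have inv: "?C P ** ?C Q = mat 1" "?C Q ** ?C P = mat 1"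
    by (simp_all add: matrix_mult_map_of_real PQ QP one)
  have "invertible (mat c - ?C (P ** diag d ** Q)) \<longleftrightarrow> (\<forall>k. c \<noteq> complex_of_real (d$k))" for c
  proof -
    let ?M = "mat c - ?C (P ** diag d ** Q)" and ?N = "mat c - ?C (diag d)"
    have scalar: "mat c ** A = A ** mat c" for A :: "complex^'k^'k"
      by (simp add: vec_eq_iff matrix_matrix_mult_def mat_def if_distrib[of "\<lambda>x. x * _"]
          if_distrib[of "\<lambda>x. _ * x"] cong: if_cong)
    have "?C (P ** diag d ** Q) ** ?C P = ?C P ** ?C (diag d)"
      by (simp add: matrix_mult_map_of_real QP flip: matrix_mul_assoc)
    then have "?M ** ?C P = ?C P ** ?N"
      by (simp add: matrix_diff_ldistrib matrix_diff_rdistrib scalar)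
    then have "det ?M * det (?C P) = det (?C P) * det ?N"
      by (metis det_mul)
    moreover have "det (?C P) \<noteq> 0"
      using inv invertible_def invertible_det_nz by blast
    ultimately have "det ?M = det ?N" by simp
    also have "det ?N = (\<Prod>k\<in>UNIV. c - complex_of_real (d$k))"
      by (subst det_diagonal) (auto simp: diag_def mat_def)
    finally show ?thesis by (simp add: invertible_det_nz)
  qed
  then show ?thesis by (auto simp: spectrum_def)
qed

lemma GDERIV_unique:
  assumes "GDERIV h x :> D" "GDERIV h x :> D'"
  shows "D = D'"
proof -
  have "(\<lambda>v. v \<bullet> D) = (\<lambda>v. v \<bullet> D')"
    using assms unfolding gderiv_def by (rule has_derivative_unique)
  then show ?thesis by (metis vector_eq_ldot)
qed

lemma gradient_eqI: "GDERIV h x :> D \<Longrightarrow> gradient h x = D"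
  unfolding gradient_def by (rule the_equality) (auto intro: GDERIV_unique)

subsection \<open>The eigenbasis at a point of the simplex\<close>

text \<open>The parameter \<open>z\<close> fixes the index type \<open>'m\<close>, which
  \<open>roots g y\<close> alone leaves open. The locale is interpreted again at other points of the
  simplex.\<close>

locale simplex_point =
  fixes g y :: "real^'n::{finite,linorder}" and z :: "real^'m::{finite,linorder}"
  assumes card: "CARD('n) = Suc CARD('m)"
    and mono: "\<And>i j. i < j \<Longrightarrow> g$i < g$j"
    and g_pos: "\<And>i. 0 < g$i"
    and simplex: "y \<in> open_simplex"
    and z_eq: "z = roots g y"
begin

lemma y_pos: "0 < y$i"
  using simplex by (simp add: open_simplex_def)

lemma y_sum: "(\<Sum>i\<in>UNIV. y$i) = 1"
  using simplex by (simp add: open_simplex_def)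

lemma node_neq: "g$i - z$k \<noteq> 0"
  using roots_neq[OF card mono y_pos] by (simp add: z_eq)

lemma z_root: "(\<Sum>i\<in>UNIV. y$i / (g$i - z$k)) = 0"
  using roots_props(3)[OF card mono y_pos] by (simp add: z_eq secular_def)

text \<open>Both sides of the divided difference identity vanish at two roots, and distinct roots
  allow division by their difference.\<close>

lemma orthogonal:
  assumes "k \<noteq> l"
  shows "(\<Sum>i\<in>UNIV. y$i / ((g$i - z$k) * (g$i - z$l))) = 0"
proof -
  have "z$k \<noteq> z$l" using roots_distinct[OF card mono y_pos assms] by (simp add: z_eq)
  moreover have "(z$l - z$k) * (\<Sum>i\<in>UNIV. y$i / ((g$i - z$k) * (g$i - z$l))) = 0"
    using secular_diff[of g "z$k" "z$l" y] node_neq z_root by (simp add: secular_def)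
  ultimately show ?thesis by simp
qed

text \<open>The weighted squared norm of the k-th eigenvector is also the slope of the secular
  function at \<open>z$k\<close>; hence it is the denominator in the derivative of that
  root.\<close>

definition "sqnorm k = (\<Sum>i\<in>UNIV. y$i / (g$i - z$k)\<^sup>2)"

lemma sqnorm_pos: "0 < sqnorm k"
  unfolding sqnorm_def using y_pos node_neq by (intro sum_pos divide_pos_pos) auto

text \<open>Its columns are the eigenvectors, so \<open>W *v c\<close> is the vector with
  eigen-coordinates \<open>c\<close>; the operators below are computed on these coordinates.\<close>

definition W :: "real^'m::{finite,linorder}^'n::{finite,linorder}" where
  "W = (\<chi> i k. 1 / (g$i - z$k))"

lemma W_nth: "(W *v c) $ i = (\<Sum>k\<in>UNIV. c$k / (g$i - z$k))"
  by (simp add: W_def matrix_vector_mult_def)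

text \<open>Orthogonality removes all cross terms, so pairing with an eigenvector reads off its
  coefficient. This gives invertibility of \<open>P\<close>, injectivity of the root map and the
  diagonal form of its derivative.\<close>

lemma project_W: "(\<Sum>i\<in>UNIV. (diag y *v (W *v c))$i / (g$i - z$k)) = c$k * sqnorm k"
proof -
  have "(\<Sum>i\<in>UNIV. (diag y *v (W *v c))$i / (g$i - z$k))
      = (\<Sum>i\<in>UNIV. \<Sum>l\<in>UNIV. c$l * (y$i / ((g$i - z$l) * (g$i - z$k))))"
    by (simp add: diag_mult_vec W_nth sum_distrib_left sum_divide_distrib ac_simps)
  also have "\<dots> = (\<Sum>l\<in>UNIV. c$l * (\<Sum>i\<in>UNIV. y$i / ((g$i - z$l) * (g$i - z$k))))"
    by (subst sum.swap) (simp add: sum_distrib_left)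
  also have "\<dots> = (\<Sum>l\<in>UNIV. if l = k then c$k * sqnorm k else 0)"
    by (intro sum.cong) (auto simp: orthogonal sqnorm_def power2_eq_square)
  finally show ?thesis by simp
qed

lemma W_Ey: "W *v c \<in> Ey y"
proof -
  have "(\<Sum>i\<in>UNIV. y$i * (W *v c)$i) = (\<Sum>i\<in>UNIV. \<Sum>k\<in>UNIV. c$k * (y$i / (g$i - z$k)))"
    by (simp add: W_nth sum_distrib_left ac_simps)
  also have "\<dots> = (\<Sum>k\<in>UNIV. c$k * (\<Sum>i\<in>UNIV. y$i / (g$i - z$k)))"
    by (subst sum.swap) (simp add: sum_distrib_left)
  finally show ?thesis by (simp add: Ey_def z_root)
qed

definition lamv :: "real^'m::{finite,linorder}" where "lamv = (\<chi> k. lam g y k)"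

definition ilamv :: "real^'m::{finite,linorder}" where "ilamv = (\<chi> k. inverse (lam g y k))"

lemma lam_pos: "0 < lam g y (k::'m::{finite,linorder})"
proof -
  have "0 < z$k"
    using roots_props(1)[OF card mono y_pos, of k] g_pos[of "idx (pos k)"] by (simp add: z_eq)
  then show ?thesis
    using sum_pos[of UNIV "\<lambda>i. g$i * y$i"] g_pos y_pos by (simp add: lam_def z_eq add_pos_pos)
qed

lemma lamv_cancel: "diag lamv *v (diag ilamv *v c) = c" "diag ilamv *v (diag lamv *v c) = c"
  using lam_pos[THEN less_imp_neq, THEN not_sym]
  by (auto simp: vec_eq_iff diag_mult_vec lamv_def ilamv_def)

lemma Lop_W: "Lop g y (W *v c) = W *v (diag lamv *v c)"
proof (rule vec_eq_iff[THEN iffD2, rule_format])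
  fix i
  let ?G = "\<Sum>j\<in>UNIV. g$j * y$j"
  have shift: "g$j * (W *v c)$j = (\<Sum>k\<in>UNIV. c$k) + (W *v (\<chi> k. z$k * c$k)) $ j" for j
  proof -
    have "g$j * (c$k / (g$j - z$k)) = c$k + z$k * c$k / (g$j - z$k)" for k
      using node_neq[of j k] by (simp add: field_simps)
    then show ?thesis by (simp add: W_nth sum_distrib_left sum.distrib)
  qed
  have "(\<Sum>j\<in>UNIV. g$j * y$j * (W *v c)$j)
      = (\<Sum>j\<in>UNIV. y$j * ((\<Sum>k\<in>UNIV. c$k) + (W *v (\<chi> k. z$k * c$k)) $ j))"
    unfolding shift[symmetric] by (simp add: ac_simps)
  also have "\<dots> = (\<Sum>k\<in>UNIV. c$k) * (\<Sum>j\<in>UNIV. y$j)"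
    using W_Ey[of "\<chi> k. z$k * c$k"]
    by (simp add: Ey_def distrib_left sum.distrib mult.commute flip: sum_distrib_right)
  \<comment> \<open>Only the constant part of \<open>shift\<close> survives, as the other part lies
    in \<open>Ey y\<close>. This mean cancels the same constant in \<open>Lop_on_Ey\<close>.\<close>
  finally have mean: "(\<Sum>j\<in>UNIV. g$j * y$j * (W *v c)$j) = (\<Sum>k\<in>UNIV. c$k)"
    by (simp add: y_sum)
  have "Lop g y (W *v c) $ i = (W *v (\<chi> k. z$k * c$k)) $ i + ?G * (W *v c) $ i"
    using Lop_on_Ey[OF W_Ey y_sum, of g c i] mean shift[of i] by (simp add: algebra_simps)
  also have "\<dots> = (\<Sum>k\<in>UNIV. z$k * c$k / (g$i - z$k) + ?G * (c$k / (g$i - z$k)))"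
    by (simp add: W_nth sum.distrib sum_distrib_left)
  also have "\<dots> = (W *v (diag lamv *v c)) $ i"
    unfolding W_nth diag_mult_vec
    by (intro sum.cong refl)
      (simp add: lamv_def lam_def z_eq[symmetric] distrib_right add_divide_distrib)
  finally show "Lop g y (W *v c) $ i = (W *v (diag lamv *v c)) $ i" .
qed

section \<open>The isomorphisms between \<open>Ey y\<close>, \<open>E\<close> and moment
  space\<close>

lemma diag_Ey: "u \<in> Ey y \<Longrightarrow> diag y *v u \<in> E"
  by (simp add: Ey_def E_def diag_mult_vec)

lemma bij_diag: "bij_betw ((*v) (diag y)) (Ey y) E"
  by (rule bij_betw_byWitness[where f' = "\<lambda>v. \<chi> i. v$i / y$i"])
    (use y_pos[THEN less_imp_neq, THEN not_sym] in
      \<open>auto simp: vec_eq_iff diag_mult_vec E_def Ey_def\<close>)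

text \<open>Level \<open>a = 0\<close> is used for \<open>E\<close>, level \<open>a = 1\<close> for
  the simplex.\<close>

lemma inj_on_moments: "inj_on (moments g :: _ \<Rightarrow> real^'m::{finite,linorder}) {v. (\<Sum>i\<in>UNIV. v$i) = a}"
proof (rule inj_onI)
  fix v w :: "real^'n::{finite,linorder}"
  assume vw: "v \<in> {v. (\<Sum>i\<in>UNIV. v$i) = a}" "w \<in> {v. (\<Sum>i\<in>UNIV. v$i) = a}"
    "moments g v = (moments g w :: real^'m::{finite,linorder})"
  have "moments g (v - w) = (0 :: real^'m::{finite,linorder})"
    using vw(3) by (simp add: linear_diff[OF moments_linear])
  then have "v - w = 0"
    using vw by (intro moments_inj[OF card mono]) (auto simp: sum_subtractf)
  then show "v = w" by simp
qed

lemma inj_on_moments_E: "inj_on (moments g :: _ \<Rightarrow> real^'m::{finite,linorder}) E"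
  using inj_on_moments[of 0] by (simp add: E_def)

definition P :: "real^'m::{finite,linorder}^'m::{finite,linorder}" where
  "P = (\<chi> l i. g$i ^ pos l) ** diag y ** W"

lemma S_W: "S_op g y (W *v c) = P *v c"
  by (simp add: S_op_def P_def moments_eq_matrix matrix_vector_mul_assoc matrix_mul_assoc)

lemma moments_W: "moments g (diag y *v (W *v c)) = P *v c"
  using S_W by (simp add: S_op_def)

lemma inj_on_S: "inj_on (S_op g y :: _ \<Rightarrow> real^'m::{finite,linorder}) (Ey y)"
proof -
  have "inj_on (moments g \<circ> (*v) (diag y) :: _ \<Rightarrow> real^'m::{finite,linorder}) (Ey y)"
    using bij_diag inj_on_moments_E by (intro comp_inj_on) (auto simp: bij_betw_def)
  then show ?thesis by (simp add: S_op_def[abs_def] comp_def)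
qed

text \<open>As \<open>P\<close> is square, a trivial kernel suffices: moments are injective on
  \<open>E\<close>, and \<open>project_W\<close> then forces every coefficient to vanish.\<close>

lemma invertible_P: "invertible P"
  unfolding invertible_left_inverse matrix_left_invertible_ker
proof (intro allI impI)
  fix c :: "real^'m::{finite,linorder}" assume "P *v c = 0"
  then have "moments g (diag y *v (W *v c)) = (0 :: real^'m::{finite,linorder})"
    by (simp add: moments_W)
  then have "diag y *v (W *v c) = 0"
    using diag_Ey[OF W_Ey, of c] by (intro moments_inj[OF card mono]) (auto simp: E_def)
  then have "c$k * sqnorm k = 0" for k using project_W[of c k] by simp
  then show "c = 0" using sqnorm_pos by (auto simp: vec_eq_iff less_le)
qed

definition Q :: "real^'m::{finite,linorder}^'m::{finite,linorder}" where "Q = matrix_inv P"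

lemma P_Q: "P ** Q = mat 1" and Q_P: "Q ** P = mat 1"
  using someI_ex[OF invertible_P[unfolded invertible_def]] by (simp_all add: Q_def matrix_inv_def)

lemma P_Q_vec: "P *v (Q *v c) = c" and Q_P_vec: "Q *v (P *v c) = c"
  by (simp_all add: matrix_vector_mul_assoc P_Q Q_P)

text \<open>The eigenvectors span \<open>Ey y\<close>: both sides have the same image under the
  injective \<open>S_op g y\<close>, because \<open>P ** Q = mat 1\<close>. The squareness of
  \<open>P\<close> stands in for a dimension count.\<close>

lemma Ey_eq_W: "u \<in> Ey y \<Longrightarrow> u = W *v (Q *v S_op g y u)"
  by (rule inj_onD[OF inj_on_S]) (simp_all add: W_Ey S_W P_Q_vec)

lemma Lop_Ey: "u \<in> Ey y \<Longrightarrow> Lop g y u \<in> Ey y"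
  by (metis Ey_eq_W Lop_W W_Ey)

lemma bij_Lop: "bij_betw (Lop g y) (Ey y) (Ey y)"
proof (rule bij_betw_byWitness[where f' = "\<lambda>u. W *v (diag ilamv *v (Q *v S_op g y u))"])
  show "\<forall>u\<in>Ey y. W *v (diag ilamv *v (Q *v S_op g y (Lop g y u))) = u"
    by (metis Ey_eq_W Lop_W S_W Q_P_vec lamv_cancel(2))
  show "\<forall>u\<in>Ey y. Lop g y (W *v (diag ilamv *v (Q *v S_op g y u))) = u"
    by (simp add: Lop_W lamv_cancel flip: Ey_eq_W)
qed (auto simp: W_Ey Lop_Ey)

lemma inv_Lop_W: "inv_into (Ey y) (Lop g y) (W *v c) = W *v (diag ilamv *v c)"
  by (rule inv_into_f_eq[OF bij_betw_imp_inj_on[OF bij_Lop]]) (simp_all add: W_Ey Lop_W lamv_cancel)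

lemma bij_S: "bij_betw (S_op g y) (Ey y) (UNIV :: (real^'m::{finite,linorder}) set)"
  by (rule bij_betw_byWitness[where f' = "\<lambda>w. W *v (Q *v w)"])
    (auto simp: W_Ey S_W P_Q_vec simp flip: Ey_eq_W)

lemma inv_S: "inv_into (Ey y) (S_op g y) w = W *v (Q *v w)"
  by (rule inv_into_f_eq[OF inj_on_S]) (simp_all add: W_Ey S_W P_Q_vec)

lemma E_cases:
  assumes "v \<in> E"
  obtains c where "v = diag y *v (W *v c)"
proof -
  obtain u where "u \<in> Ey y" "v = diag y *v u"
    using assms bij_betw_imp_surj_on[OF bij_diag] by auto
  with Ey_eq_W[of u] that show ?thesis by metis
qed

lemma y_of_U_moments:
  assumes "x \<in> closed_simplex"
  shows "y_of_U g (moments g x :: real^'m::{finite,linorder}) = x"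
proof -
  have "inj_on (moments g :: _ \<Rightarrow> real^'m::{finite,linorder}) closed_simplex"
    by (rule inj_on_subset[OF inj_on_moments[of 1]]) (auto simp: closed_simplex_def)
  then show ?thesis using assms unfolding y_of_U_def by (intro inv_into_f_f)
qed

lemma open_simplex_closed: "x \<in> open_simplex \<Longrightarrow> x \<in> closed_simplex"
  by (auto simp: open_simplex_def closed_simplex_def less_imp_le)

lemma inv_moments_E: "inv_into E (moments g) w = diag y *v (W *v (Q *v w))"
  by (rule inv_into_f_eq[OF inj_on_moments_E]) (simp_all add: diag_Ey W_Ey moments_W P_Q_vec)

section \<open>The inverse of \<open>Bmat f y\<close> on \<open>E\<close> and the diagonalisation of
  \<open>A_op\<close>\<close>

context
  fixes f :: "'n::{finite,linorder} \<Rightarrow> 'n::{finite,linorder} \<Rightarrow> real"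
  assumes f: "\<And>i j. i \<noteq> j \<Longrightarrow> f i j = g$i + g$j"
begin

abbreviation "LY \<equiv> \<lambda>v. - (diag y *v inv_into (Ey y) (Lop g y) (inv_into (Ey y) ((*v) (diag y)) v))"

lemma LY_W: "LY (diag y *v (W *v c)) = diag y *v (W *v (diag ilamv *v - c))"
  using bij_betw_inv_into_left[OF bij_diag W_Ey]
  by (simp add: inv_Lop_W linear_neg[OF matrix_vector_mul_linear])

lemma B_W: "Bmat f y *v (diag y *v (W *v c)) = diag y *v (W *v (diag lamv *v - c))"
  using Bmat_diag[of f g y, OF f] by (simp add: Lop_W linear_neg[OF matrix_vector_mul_linear])

lemma E_W: "diag y *v (W *v c) \<in> E"
  using diag_Ey[OF W_Ey] .

text \<open>In eigen-coordinates \<open>Bmat f y\<close> acts as minus \<open>diag lamv\<close> and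
  \<open>LY\<close> as minus \<open>diag ilamv\<close>, so the signs and the factors cancel in
  either order.\<close>

lemma LY_inverse:
  assumes "v \<in> E"
  shows "LY v \<in> E" "Bmat f y *v v \<in> E" "LY (Bmat f y *v v) = v" "Bmat f y *v LY v = v"
proof -
  obtain c where c: "v = diag y *v (W *v c)" using E_cases[OF assms] .
  have neg: "- (diag d *v - x) = diag d *v x" for d x :: "real^'m::{finite,linorder}"
    by (simp add: linear_neg[OF matrix_vector_mul_linear])
  show "LY v \<in> E" "Bmat f y *v v \<in> E" by (simp_all only: c LY_W B_W E_W)
  show "LY (Bmat f y *v v) = v" "Bmat f y *v LY v = v"
    by (simp_all only: c LY_W B_W neg lamv_cancel)
qed

lemma bij_B: "bij_betw ((*v) (Bmat f y)) E E"
  using LY_inverse by (intro bij_betw_byWitness[where f' = LY]) blast+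

lemma inv_B: "v \<in> E \<Longrightarrow> inv_into E ((*v) (Bmat f y)) v = LY v"
  using LY_inverse by (intro inv_into_f_eq[OF bij_betw_imp_inj_on[OF bij_B]])

text \<open>The minus sign in \<open>A_op\<close> cancels the one in the inverse of
  \<open>Bmat f y\<close>, leaving positive eigenvalues.\<close>

lemma A_op_eq: "A_op g f (moments g y) w = P *v (diag ilamv *v (Q *v w))"
  by (simp add: A_op_def y_of_U_moments open_simplex_closed[OF simplex] inv_moments_E
      inv_B E_W LY_W moments_W linear_neg[OF moments_linear]
      linear_neg[OF matrix_vector_mul_linear])

lemma A_mat_eq: "A_mat g f (moments g y) = P ** diag ilamv ** Q"
  unfolding A_mat_def A_op_eq[abs_def] matrix_vector_mul_assoc matrix_mul_assoc by simp

lemma A_op_matrix: "A_op g f (moments g y) = (*v) (P ** diag ilamv ** Q)"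
  by (simp add: fun_eq_iff A_op_eq flip: matrix_vector_mul_assoc)

lemma A_op_S:
  fixes w :: "real^'m::{finite,linorder}"
  shows "A_op g f (moments g y) w
    = S_op g y (inv_into (Ey y) (Lop g y) (inv_into (Ey y) (S_op g y) w))"
  by (simp add: A_op_eq inv_S inv_Lop_W S_W)

end

text \<open>For given roots the root equations are linear in the weights. Hence \<open>x - y\<close>
  pairs to zero with every eigenvector, and its eigen-coordinates vanish.\<close>

lemma roots_unique:
  assumes x: "x \<in> open_simplex" and xz: "roots g x = z"
  shows "x = y"
proof -
  have x_pos: "0 < x$i" for i using x by (simp add: open_simplex_def)
  have x_root: "(\<Sum>i\<in>UNIV. x$i / (g$i - z$k)) = 0" for k
    using roots_props(3)[OF card mono x_pos] by (simp add: xz secular_def)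
  have "x - y \<in> E"
    using x y_sum by (simp add: E_def open_simplex_def sum_subtractf)
  then obtain c where c: "x - y = diag y *v (W *v c)" by (rule E_cases)
  have "c$k * sqnorm k = (\<Sum>i\<in>UNIV. (x - y)$i / (g$i - z$k))" for k
    by (simp only: c project_W)
  also have "\<dots> k = 0" for k
    by (simp add: diff_divide_distrib sum_subtractf x_root z_root)
  finally have "c = 0" using sqnorm_pos by (auto simp: vec_eq_iff less_le)
  with c show ?thesis by simp
qed

subsection \<open>Differentiating the roots in moment coordinates\<close>

text \<open>\<psi> inverts the moment map on the hyperplane \<open>\<Sum>\<^sub>i y\<^sub>i = 1\<close>: it extends \<^const>\<open>y_of_U\<close> from the image
  of the simplex to an affine map of the whole space.\<close>

definition \<psi> :: "real^'m::{finite,linorder} \<Rightarrow> real^'n::{finite,linorder}" where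
  "\<psi> V = y + diag y *v (W *v (Q *v (V - moments g y)))"

text \<open>This is the image of the open simplex under the moment map, written as a preimage under
  \<open>\<psi>\<close> so that openness follows from continuity.\<close>

definition nbhd :: "(real^'m::{finite,linorder}) set" where
  "nbhd = {V. \<forall>i. 0 < \<psi> V $ i}"

lemma \<psi>_affine: "\<psi> V = (y - (diag y ** W ** Q) *v moments g y) + (diag y ** W ** Q) *v V"
  by (simp add: \<psi>_def matrix_vector_mul_assoc matrix_mul_assoc algebra_simps matrix_vector_mult_diff_distrib)

lemma \<psi>_base: "\<psi> (moments g y) = y"
  by (simp add: \<psi>_def)

lemma \<psi>_has_derivative: "(\<psi> has_derivative (\<lambda>h. diag y *v (W *v (Q *v h)))) (at V)"
proof -
  have "(\<psi> has_derivative (\<lambda>h. (diag y ** W ** Q) *v h)) (at V)"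
    unfolding \<psi>_affine[abs_def]
    by (auto intro!: derivative_eq_intros bounded_linear_imp_has_derivative)
  then show ?thesis by (simp add: matrix_vector_mul_assoc matrix_mul_assoc)
qed

lemma isCont_\<psi>: "isCont \<psi> V"
  using \<psi>_has_derivative by (rule has_derivative_continuous)

lemma open_nbhd: "open nbhd"
proof -
  have "open (\<psi> -` {x. \<forall>i. 0 < x$i})"
    by (intro continuous_open_vimage open_positive allI isCont_\<psi>)
  then show ?thesis by (simp add: nbhd_def vimage_def)
qed

lemma base_nbhd: "moments g y \<in> nbhd"
  by (simp add: nbhd_def \<psi>_base y_pos)

lemma moments_\<psi>: "moments g (\<psi> V) = V"
  by (simp add: \<psi>_def linear_add[OF moments_linear] moments_W P_Q_vec)

lemma \<psi>_simplex:
  assumes "V \<in> nbhd"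
  shows "\<psi> V \<in> open_simplex"
proof -
  have pos: "0 < \<psi> V $ i" for i using assms by (simp add: nbhd_def)
  have sum: "(\<Sum>i\<in>UNIV. \<psi> V $ i) = 1"
    using diag_Ey[OF W_Ey, of "Q *v (V - moments g y)"] y_sum
    by (simp add: \<psi>_def sum.distrib E_def)
  have "\<psi> V $ i < 1" for i
  proof -
    \<comment> \<open>There are at least two coordinates, since \<open>CARD('n)\<close> is the
      successor of a positive number; a second positive coordinate keeps the i-th below 1.\<close>
    have "\<not> UNIV \<subseteq> {i}"
    proof
      assume "UNIV \<subseteq> {i}"
      from card_mono[OF _ this] show False using card by simp
    qed
    then obtain k where "k \<noteq> i" by auto
    have "0 < (\<Sum>l\<in>UNIV - {i}. \<psi> V $ l)"
      using \<open>k \<noteq> i\<close> pos by (intro sum_pos) auto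
    then show ?thesis using sum sum.remove[of UNIV i "\<lambda>l. \<psi> V $ l"] by simp
  qed
  with pos sum show ?thesis by (simp add: open_simplex_def)
qed

lemma z_of_U_nbhd:
  assumes "V \<in> nbhd"
  shows "z_of_U g V = (roots g (\<psi> V) :: real^'m::{finite,linorder})"
  using y_of_U_moments[OF open_simplex_closed[OF \<psi>_simplex[OF assms]]]
  by (simp add: z_of_U_def moments_\<psi>)

lemma U_of_z_roots:
  assumes "x \<in> open_simplex"
  shows "U_of_z g (roots g x :: real^'m::{finite,linorder}) = (moments g x :: real^'m::{finite,linorder})"
proof -
  \<comment> \<open>Injectivity of the root map is needed at \<open>x\<close>, so the locale is
    instantiated there.\<close>
  interpret x: simplex_point g x "roots g x :: real^'m::{finite,linorder}"
    using card mono g_pos assms by unfold_locales auto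
  have "inv_into open_simplex (roots g) (roots g x :: real^'m::{finite,linorder}) = x"
    using assms x.roots_unique
    by (metis (mono_tags, lifting) f_inv_into_f imageI inv_into_into)
  then show ?thesis by (simp add: U_of_z_def)
qed

lemma U_of_z_of_U: "V \<in> nbhd \<Longrightarrow> U_of_z g (z_of_U g V) = V"
  by (simp add: z_of_U_nbhd U_of_z_roots \<psi>_simplex moments_\<psi>)

lemma z_of_U_base: "z_of_U g (moments g y) = z"
  using z_of_U_nbhd[OF base_nbhd] by (simp add: \<psi>_base flip: z_eq)

lemma continuous_z_of_U: "continuous_on nbhd (z_of_U g :: _ \<Rightarrow> real^'m::{finite,linorder})"
proof -
  have "isCont (\<lambda>V. roots g (\<psi> V) :: real^'m::{finite,linorder}) V" if "V \<in> nbhd" for V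
  proof -
    have "isCont (\<lambda>x. roots g x $ j) (\<psi> V)" for j :: "'m::{finite,linorder}"
      using that by (intro isCont_roots[OF card mono]) (auto simp: nbhd_def)
    then have "isCont (\<lambda>V. roots g (\<psi> V) $ j) V" for j :: "'m::{finite,linorder}"
      using isCont_o2[OF isCont_\<psi>] by blast
    then show ?thesis
      unfolding isCont_def by (intro vec_tendstoI)
  qed
  then have "continuous_on nbhd (\<lambda>V. roots g (\<psi> V) :: real^'m::{finite,linorder})"
    by (simp add: continuous_at_imp_continuous_on)
  then show ?thesis
    by (rule continuous_on_cong[THEN iffD1, OF refl, rotated]) (simp add: z_of_U_nbhd)
qed

lemma z_of_U_has_derivative_component:
  fixes j :: "'m::{finite,linorder}"
  shows "((\<lambda>V. z_of_U g V $ j) has_derivative (\<lambda>h. - (Q *v h) $ j)) (at (moments g y))"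
proof -
  have "((\<lambda>x. roots g x $ j) has_derivative
      (\<lambda>h. - (\<Sum>i\<in>UNIV. h$i / (g$i - z$j)) / sqnorm j)) (at (\<psi> (moments g y)))"
    using roots_has_derivative[OF card mono y_pos, of j] by (simp add: sqnorm_def \<psi>_base flip: z_eq)
  \<comment> \<open>The derivative of \<open>\<psi>\<close> has eigen-coordinates
    \<open>Q *v h\<close>; \<open>project_W\<close> turns the numerator into
    \<open>(Q *v h) $ j * sqnorm j\<close>, and the norm cancels.\<close>
  from has_derivative_compose[OF \<psi>_has_derivative this]
  have "((\<lambda>V. roots g (\<psi> V) $ j) has_derivative (\<lambda>h. - (Q *v h) $ j)) (at (moments g y))"
    using sqnorm_pos[of j] by (simp add: project_W)
  then show ?thesis
    by (rule has_derivative_transform_within_open[OF _ open_nbhd base_nbhd]) (simp add: z_of_U_nbhd)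
qed

lemma z_of_U_has_derivative: "(z_of_U g has_derivative (\<lambda>h. - (Q *v h))) (at (moments g y))"
  unfolding has_derivative_componentwise_within[of "z_of_U g"]
  using z_of_U_has_derivative_component by (auto simp: Basis_vec_def inner_axis)

text \<open>The inverse function theorem is applied to \<open>z_of_U g\<close>, continuous on
  \<open>nbhd\<close> and differentiable at the base point, with \<open>U_of_z g\<close> as its left
  inverse on \<open>nbhd\<close>.\<close>

lemma U_of_z_has_derivative: "(U_of_z g has_derivative (\<lambda>c. - (P *v c))) (at z)"
proof -
  have "(U_of_z g has_derivative (\<lambda>c. - (P *v c))) (at (z_of_U g (moments g y)))"
    by (rule has_derivative_inverse_strong[OF open_nbhd base_nbhd continuous_z_of_U U_of_z_of_U
          z_of_U_has_derivative])
      (auto simp: fun_eq_iff linear_neg[OF matrix_vector_mul_linear] Q_P_vec)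
  then show ?thesis by (simp add: z_of_U_base)
qed

lemma jacobian_U_of_z: "jacobian (U_of_z g) (at z) = - P"
proof -
  have "(\<lambda>c. - (P *v c)) = (*v) (- P)"
    by (simp add: fun_eq_iff vec_eq_iff matrix_vector_mult_def sum_negf)
  then show ?thesis
    unfolding jacobian_def frechet_derivative_at[OF U_of_z_has_derivative, symmetric] by simp
qed

lemma gradient_z_of_U:
  fixes j :: "'m::{finite,linorder}"
  shows "GDERIV (\<lambda>V. z_of_U g V $ j) (moments g y) :> - row j Q"
  unfolding gderiv_def
  using z_of_U_has_derivative_component[of j]
  by (simp add: inner_vec_def matrix_vector_mult_def row_def sum_negf mult.commute)

text \<open>Cancelling \<open>Q ** P\<close> gives \<open>Q ** A = diag ilamv ** Q\<close>, so the
  rows of \<open>Q\<close> are left eigenvectors.\<close>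

lemma row_Q_eigen: "(- row j Q) v* (P ** diag ilamv ** Q) = ilamv$j *s (- row j Q)"
proof -
  define A where "A = P ** diag ilamv ** Q"
  have "Q ** A = diag ilamv ** Q"
    by (simp add: A_def matrix_mul_assoc Q_P)
  then have "(Q ** A)$j$k = ilamv$j * Q$j$k" for k
    by (simp add: diag_matrix_mult)
  then have "(\<Sum>i\<in>UNIV. Q$j$i * A$i$k) = ilamv$j * Q$j$k" for k
    by (simp add: matrix_matrix_mult_def)
  then show ?thesis
    by (simp add: vec_eq_iff vector_matrix_mult_def row_def sum_negf mult.commute flip: A_def)
qed

end

theorem proposition7p4:
  fixes N :: nat
    and g y :: "real^'n::{finite,linorder}"
    and f :: "'n \<Rightarrow> 'n \<Rightarrow> real"
    and U z :: "real^'m::{finite,linorder}"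
  assumes "N \<ge> 2" and "CARD('n) = N" and "CARD('m) = N - 1"
    and "\<And>i. 0 < g$i" and "\<And>i j. i < j \<Longrightarrow> g$i < g$j"
    and "\<And>i j. i \<noteq> j \<Longrightarrow> f i j = g$i + g$j"
    and "y \<in> open_simplex"
    and "U = moments g y"
    and "z = roots g y"
  shows
    "linear ((*v) (diag y)) \<and> bij_betw ((*v) (diag y)) (Ey y) E
   \<and> bij_betw ((*v) (Bmat f y)) E E
   \<and> bij_betw (Lop g y) (Ey y) (Ey y)
   \<and> (\<forall>v\<in>E. inv_into E ((*v) (Bmat f y)) v
            = - (diag y *v inv_into (Ey y) (Lop g y) (inv_into (Ey y) ((*v) (diag y)) v)))
   \<and> bij_betw (S_op g y) (Ey y) (UNIV :: (real^'m::{finite,linorder}) set)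
   \<and> linear (A_op g f U)
   \<and> (\<forall>w. A_op g f U w
            = S_op g y (inv_into (Ey y) (Lop g y) (inv_into (Ey y) (S_op g y) w)))
   \<and> spectrum (A_mat g f U) = range (\<lambda>j::'m::{finite,linorder}. complex_of_real (inverse (lam g y j)))
   \<and> U_of_z g differentiable (at z)
   \<and> A_mat g f (U_of_z g z) ** jacobian (U_of_z g) (at z)
       = jacobian (U_of_z g) (at z) ** diag (\<chi> j. inverse (lam g y j))
   \<and> (\<forall>j. GDERIV (\<lambda>V. z_of_U g V $ j) U :> gradient (\<lambda>V. z_of_U g V $ j) U
        \<and> gradient (\<lambda>V. z_of_U g V $ j) U v* A_mat g f U
            = inverse (lam g y j) *s gradient (\<lambda>V. z_of_U g V $ j) U)"
proof -
  \<comment> \<open>\<open>N - 1\<close> is a truncated difference of naturals;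
    \<open>N \<ge> 2\<close> makes it an exact one.\<close>
  have card: "CARD('n) = Suc CARD('m)" using assms(1-3) by simp
  interpret simplex_point g y z
    using card assms(4,5,7,9) by unfold_locales auto
  note f = assms(6)
  have A: "A_mat g f U = P ** diag ilamv ** Q"
    using A_mat_eq[of f, OF f] by (simp add: assms(8))
  have Uz: "U_of_z g z = U"
    using U_of_z_roots[OF assms(7)] by (simp add: assms(8,9))
  have spec: "spectrum (A_mat g f U) = range (\<lambda>j::'m. complex_of_real (inverse (lam g y j)))"
    unfolding A spectrum_similar_diag[OF P_Q Q_P] by (simp add: ilamv_def)
  have diffble: "U_of_z g differentiable (at z)"
    using U_of_z_has_derivative by (auto simp: differentiable_def)
  \<comment> \<open>The Jacobian is \<open>- P\<close>, and the sign passes through both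
    products.\<close>
  have "P ** diag ilamv ** Q ** - P = - P ** diag ilamv"
  proof -
    have neg: "X ** - P = - (X ** P)" "- P ** X = - (P ** X)" for X :: "real^'m::{finite,linorder}^'m::{finite,linorder}"
      by (simp_all add: vec_eq_iff matrix_matrix_mult_def sum_negf)
    show ?thesis by (simp add: neg Q_P flip: matrix_mul_assoc)
  qed
  then have jac: "A_mat g f (U_of_z g z) ** jacobian (U_of_z g) (at z)
      = jacobian (U_of_z g) (at z) ** diag (\<chi> j. inverse (lam g y j))"
    unfolding Uz A jacobian_U_of_z ilamv_def .
  have grad: "gradient (\<lambda>V. z_of_U g V $ j) U = - row j Q" for j :: 'm
    unfolding assms(8) by (rule gradient_eqI[OF gradient_z_of_U])
  have grad_eigen: "GDERIV (\<lambda>V. z_of_U g V $ j) U :> gradient (\<lambda>V. z_of_U g V $ j) U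
      \<and> gradient (\<lambda>V. z_of_U g V $ j) U v* A_mat g f U
          = inverse (lam g y j) *s gradient (\<lambda>V. z_of_U g V $ j) U" for j :: 'm
    unfolding grad A using gradient_z_of_U[of j] row_Q_eigen[of j] by (simp add: ilamv_def assms(8))
  have lin: "linear (A_op g f U)"
    using A_op_matrix[of f, OF f] matrix_vector_mul_linear[of "P ** diag ilamv ** Q"]
    by (simp add: assms(8))
  show ?thesis
    by (intro conjI ballI allI matrix_vector_mul_linear bij_diag bij_B[of f, OF f] bij_Lop
        inv_B[of f, OF f] bij_S lin A_op_S[of f, OF f, folded assms(8)] spec diffble jac
        grad_eigen[THEN conjunct1] grad_eigen[THEN conjunct2])
qed

end
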